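(* Let $p$ be an odd prime, let $s,h,t,r$ be positive integers with $r$ odd, $t\mid h$, $s\le h$, $\gcd(r,p)=1$, and let $q=p^h$. Assume that $\mathbb{F}_q$ is the splitting field of $g(x)=x^{rp^s}+ax^{rp^s-1}+bx^{rp^s-2}+c\in\mathbb{F}_{p^t}[x]$ with $a,b,c\ne0$, and that $\alpha_1,\dots,\alpha_{rp^s}$ are all the roots of $g(x)$ and are pairwise distinct. Let $v_i\in\mathbb{F}_{q^2}$ be such that $v_i^2=(g'(\alpha_i))^{-1}$ for $1\le i\le rp^s$ (such $v_i$ exist). Let $\boldsymbol{\alpha}=(\alpha_1,\dots,\alpha_{rp^s})$ and $\boldsymbol{v}=(v_1,\dots,v_{rp^s})$. Let $\eta_2=2b^{-1}$ and $\eta_1=2ab^{-1}$. Set $$\mathcal{S}_1=\Big\{\sum_{i=0}^{\frac{rp^s-1}{2}-1}f_ix^i+\frac2b\,f_{\frac{rp^s-1}{2}-1}\Big(a\,x^{\frac{rp^s-1}{2}}+x^{\frac{rp^s-1}{2}+1}\Big): f_i\in\mathbb{F}_{q^2}\text{ for }0\le i\le\tfrac{rp^s-1}{2}-1\Big\}.$$ Then $\mathcal{C}_1=ev_{\boldsymbol{\alpha},\boldsymbol{v}}(\mathcal{S}_1)$ is a $[rp^s,\,\frac{rp^s-1}{2},\,\ge\frac{rp^s-1}{2}]$ self-orthogonal TGRS code over $\mathbb{F}_{q^2}$.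
   Context: For $\boldsymbol{\alpha}\in\mathbb{F}^n$ with distinct entries and $\boldsymbol{v}\in(\mathbb{F}^* )^n$ ($\mathbb{F}$ a finite field; here $\mathbb{F}=\mathbb{F}_{q^2}$), $ev_{\boldsymbol{\alpha},\boldsymbol{v}}(f)=(v_1f(\alpha_1),\dots,v_nf(\alpha_n))$ for $f\in\mathbb{F}[x]$. For a $k\times(n-k)$ matrix $(\eta_{ij})$ over $\mathbb{F}$, the twisted generalized Reed-Solomon (TGRS) code is the image under $ev_{\boldsymbol{\alpha},\boldsymbol{v}}$ of $\{\sum_{i=0}^{k-1}f_ix^i+\sum_{i=0}^{k-1}f_i\sum_{j=1}^{n-k}\eta_{i+1,j}x^{k-1+j}:f_i\in\mathbb{F}\}$. A linear code is $[n,k,\ge d]$ if it has length $n$, dimension $k$ and minimum Hamming distance at least $d$. It is self-orthogonal if $\mathcal{C}\subseteq\mathcal{C}^\perp$ for the Euclidean inner product. *)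

theory Defs
  imports
    "HOL-Analysis.Cartesian_Space"
    "HOL-Computational_Algebra.Polynomial"
    "HOL-Computational_Algebra.Primes"
begin

definition is_subfield :: "'a::field set \<Rightarrow> bool" where
  "is_subfield K \<longleftrightarrow>
     0 \<in> K \<and> 1 \<in> K \<and>
     (\<forall>x\<in>K. \<forall>y\<in>K. x + y \<in> K \<and> x * y \<in> K) \<and>
     (\<forall>x\<in>K. - x \<in> K \<and> inverse x \<in> K)"

definition generated_subfield :: "'a::field set \<Rightarrow> 'a set" where
  "generated_subfield A = \<Inter>{M. is_subfield M \<and> A \<subseteq> M}"

definition splits_over :: "'a::field poly \<Rightarrow> 'a set \<Rightarrow> bool" where
  "splits_over g L \<longleftrightarrow>
     (\<exists>rs. set rs \<subseteq> L \<and> g = smult (lead_coeff g) (\<Prod>x\<leftarrow>rs. [:- x, 1:]))"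

text \<open>\<open>L\<close> is a splitting field of \<open>g \<in> K[x]\<close>, where \<open>K\<close> and \<open>L\<close> are subfields
  of one ambient field, given by the type.\<close>

definition is_splitting_field :: "'a::field set \<Rightarrow> 'a set \<Rightarrow> 'a poly \<Rightarrow> bool" where
  "is_splitting_field K L g \<longleftrightarrow>
     is_subfield K \<and> is_subfield L \<and> K \<subseteq> L \<and>
     g \<noteq> 0 \<and> (\<forall>i. coeff g i \<in> K) \<and>
     splits_over g L \<and>
     L = generated_subfield (K \<union> {x \<in> L. poly g x = 0})"

definition hamming_dist :: "'a ^ 'n \<Rightarrow> 'a ^ 'n \<Rightarrow> nat" where
  "hamming_dist x y = card {i. x $ i \<noteq> y $ i}"

text \<open>For a code with fewer than two words this is \<open>0\<close>, so a positive lower bound on it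
  is never vacuously true.\<close>

definition min_hamming_dist :: "('a ^ 'n) set \<Rightarrow> nat" where
  "min_hamming_dist C = Inf {hamming_dist x y | x y. x \<in> C \<and> y \<in> C \<and> x \<noteq> y}"

definition is_linear_code :: "nat \<Rightarrow> nat \<Rightarrow> nat \<Rightarrow> ('a::field ^ 'n) set \<Rightarrow> bool" where
  "is_linear_code n k d C \<longleftrightarrow>
     vec.subspace C \<and> CARD('n) = n \<and> vec.dim C = k \<and> min_hamming_dist C \<ge> d"

definition dual_code :: "('a::field ^ 'n) set \<Rightarrow> ('a ^ 'n) set" where
  "dual_code C = {x. \<forall>y\<in>C. (\<Sum>i\<in>UNIV. x $ i * y $ i) = 0}"

definition self_orthogonal :: "('a::field ^ 'n) set \<Rightarrow> bool" where
  "self_orthogonal C \<longleftrightarrow> C \<subseteq> dual_code C"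

definition ev :: "'a::field ^ 'n \<Rightarrow> 'a ^ 'n \<Rightarrow> 'a poly \<Rightarrow> 'a ^ 'n" where
  "ev \<alpha> v f = (\<chi> i. v $ i * poly f (\<alpha> $ i))"

text \<open>The \<open>k \<times> (n - k)\<close> matrix is a function of which only the
  entries \<open>\<eta> i j\<close> with \<open>1 \<le> i \<le> k\<close> and \<open>1 \<le> j \<le> n - k\<close> matter.\<close>

definition tgrs_polys :: "nat \<Rightarrow> nat \<Rightarrow> (nat \<Rightarrow> nat \<Rightarrow> 'a::field) \<Rightarrow> 'a poly set" where
  "tgrs_polys n k \<eta> =
     {(\<Sum>i<k. monom (f i) i) +
      (\<Sum>i<k. smult (f i) (\<Sum>j=1..n-k. monom (\<eta> (i + 1) j) (k - 1 + j))) | f :: nat \<Rightarrow> 'a. True}"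

definition is_tgrs_code ::
  "'a::field ^ 'n \<Rightarrow> 'a ^ 'n \<Rightarrow> nat \<Rightarrow> ('a ^ 'n) set \<Rightarrow> bool" where
  "is_tgrs_code \<alpha> v k C \<longleftrightarrow>
     inj (($) \<alpha>) \<and> (\<forall>i. v $ i \<noteq> 0) \<and> 1 \<le> k \<and> k \<le> CARD('n) \<and>
     (\<exists>\<eta>. C = ev \<alpha> v ` tgrs_polys CARD('n) k \<eta>)"

end

theory Submission
  imports Defs
begin

text \<open>Let \<open>n = rp\<^sup>s\<close> and \<open>k = (n - 1)/2\<close>. Lagrange interpolation at the roots of \<open>g\<close> gives
  \<open>\<Sum>\<^sub>i \<alpha>\<^sub>i\<^sup>m / g'(\<alpha>\<^sub>i) = 0\<close> for \<open>m < n - 1\<close> and \<open>1\<close> for \<open>m = n - 1\<close>; reduction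
  modulo \<open>g\<close> yields \<open>-a\<close> and \<open>a\<^sup>2 - b\<close> for \<open>m = n\<close> and \<open>m = n + 1\<close>. The inner product
  of two code words thus depends only on the three top coefficients of a product of degree at
  most \<open>n + 1\<close>, and the twists \<open>2a/b\<close> and \<open>2/b\<close> make it vanish. Dimension and distance
  follow since a nonzero element of \<open>\<S>\<^sub>1\<close> has at most \<open>k + 1\<close> roots. The \<open>v\<^sub>i\<close> exist
  since every element of a field of odd order \<open>q\<close> is a square in the field of order \<open>q\<^sup>2\<close>.\<close>

section \<open>Existence of square roots in finite fields\<close>

text \<open>Multiplication by \<open>x\<close> permutes the nonzero elements of \<open>L\<close>, so
  their nonzero product cancels from both sides.\<close>

lemma subfield_power_card:
  fixes L :: "'a::field set"
  assumes L: "is_subfield L" "finite L" and x: "x \<in> L" "x \<noteq> 0"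
  shows "x ^ (card L - 1) = 1"
proof -
  let ?T = "L - {0}"
  have inj: "inj_on ((*) x) ?T" using x by (auto simp: inj_on_def)
  have sub: "(*) x ` ?T \<subseteq> ?T" using L x unfolding is_subfield_def by auto
  have img: "(*) x ` ?T = ?T"
    using endo_inj_surj[OF _ sub inj] L(2) by simp
  have "\<Prod>?T = (\<Prod>y\<in>?T. x * y)"
    using prod.reindex[OF inj, of "\<lambda>y. y"] img by simp
  also have "\<dots> = x ^ card ?T * \<Prod>?T" by (simp add: prod.distrib)
  finally have "x ^ card ?T = 1" using L(2) by (auto simp: prod_zero_iff)
  moreover have "card ?T = card L - 1"
    using L unfolding is_subfield_def by (simp add: card_Diff_singleton)
  ultimately show ?thesis by simp
qed

text \<open>Euler's criterion by counting: the nonzero squares lie among the at most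
  \<open>m\<close> roots of \<open>X^m - 1\<close>, and squaring the \<open>2 * m\<close> nonzero
  elements is at most two-to-one, so both sets coincide.\<close>

lemma finite_field_square_exists:
  fixes x :: "'a::{field,finite}"
  assumes Q: "odd CARD('a)" and x: "x ^ ((CARD('a) - 1) div 2) = 1"
  shows "\<exists>w. w ^ 2 = x"
proof -
  define m where "m = (CARD('a) - 1) div 2"
  let ?T = "UNIV - {0::'a}" and ?S = "(\<lambda>x::'a. x ^ 2)"
  let ?p = "monom 1 m - 1 :: 'a poly"
  define R where "R = {x::'a. poly ?p x = 0}"
  have "card {0::'a, 1} \<le> CARD('a)" by (rule card_mono) auto
  hence c2: "CARD('a) \<ge> 2" by simp
  have m2: "2 * m = CARD('a) - 1" using Q unfolding m_def by simp
  with c2 have m: "m > 0" by simp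
  have deg: "degree ?p = m"
    using m by (intro antisym degree_le le_degree) (auto simp: coeff_1)
  have "?p \<noteq> 0" using deg m by auto
  hence cR: "card R \<le> m"
    using card_poly_roots_bound[of ?p] deg unfolding R_def by simp
  have U: "is_subfield (UNIV :: 'a set)" by (simp add: is_subfield_def)
  have SR: "?S ` ?T \<subseteq> R"
    using subfield_power_card[OF U] m2
    by (auto simp: R_def poly_monom simp flip: power_mult)
  have fib: "card {z::'a. z ^ 2 = y} \<le> 2" for y
  proof (cases "\<exists>w. w ^ 2 = y")
    case True
    then obtain w where "w ^ 2 = y" by blast
    hence "{z. z ^ 2 = y} \<subseteq> {w, -w}" by (auto simp: power2_eq_iff)
    hence "card {z. z ^ 2 = y} \<le> card {w, -w}" by (intro card_mono) auto
    also have "\<dots> \<le> 2" by (simp add: card_insert_if)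
    finally show ?thesis .
  qed simp
  have "card ?T \<le> card (\<Union>y\<in>?S ` ?T. {z. z ^ 2 = y})" by (rule card_mono) auto
  also have "\<dots> \<le> (\<Sum>y\<in>?S ` ?T. card {z. z ^ 2 = y})" by (rule card_UN_le) simp
  also have "\<dots> \<le> (\<Sum>y\<in>?S ` ?T. 2)" by (rule sum_mono) (rule fib)
  finally have "2 * m \<le> 2 * card (?S ` ?T)" using m2 by (simp add: card_Diff_singleton)
  with cR have "card R \<le> card (?S ` ?T)" by linarith
  hence "?S ` ?T = R" using SR by (intro card_seteq) auto
  moreover have "x \<in> R" using x by (simp add: R_def poly_monom m_def)
  ultimately show ?thesis by blast
qed

text \<open>With \<open>card L = 2 * l + 1\<close>, Euler's exponent is
  \<open>2 * l * (l + 1)\<close>, a multiple of the order \<open>2 * l\<close> of the group of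
  nonzero elements of \<open>L\<close>.\<close>

lemma subfield_square_exists:
  fixes L :: "'a::{field,finite} set"
  assumes L: "is_subfield L" "CARD('a) = card L ^ 2" "odd (card L)" and x: "x \<in> L"
  shows "\<exists>w. w ^ 2 = x"
proof (cases "x = 0")
  case False
  obtain l where l: "card L = 2 * l + 1" using L(3) by (metis oddE)
  have "(CARD('a) - 1) div 2 = 2 * l * (l + 1)"
    unfolding L(2) l by (simp add: power2_eq_square algebra_simps)
  moreover have "x ^ (2 * l) = 1" using subfield_power_card[OF L(1) _ x False] l by simp
  ultimately show ?thesis using L(2,3)
    by (intro finite_field_square_exists) (simp_all only: power_mult power_one even_power, simp_all)
qed (auto intro: exI[of _ 0])

section \<open>Roots and polynomial values in the splitting field\<close>

text \<open>A root anywhere in the ambient field kills one of the linear factors, and these have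
  their roots in \<open>L\<close>.\<close>

lemma is_splitting_field_roots:
  assumes "is_splitting_field K L g" "poly g x = 0"
  shows "x \<in> L"
proof -
  obtain rs where rs: "set rs \<subseteq> L" "g = smult (lead_coeff g) (\<Prod>x\<leftarrow>rs. [:- x, 1:])"
    and g0: "g \<noteq> 0"
    using assms(1) unfolding is_splitting_field_def splits_over_def by blast
  have "poly (smult (lead_coeff g) (\<Prod>x\<leftarrow>rs. [:- x, 1:])) x = 0"
    using rs(2) assms(2) by metis
  hence "poly (\<Prod>x\<leftarrow>rs. [:- x, 1:]) x = 0" using g0 by simp
  hence "x \<in> set rs" by (induction rs) auto
  with rs show ?thesis by blast
qed

lemma subfield_power:
  assumes "is_subfield L" "x \<in> L"
  shows "x ^ m \<in> L"
  using assms by (induction m) (auto simp: is_subfield_def)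

lemma subfield_poly:
  assumes "is_subfield L" "x \<in> L" "\<And>i. coeff f i \<in> L"
  shows "poly f x \<in> L"
proof -
  have "(\<Sum>i\<in>I. coeff f i * x ^ i) \<in> L" if "finite I" for I
    using that assms subfield_power[OF assms(1,2)]
    by (induction rule: finite_induct) (auto simp: is_subfield_def)
  thus ?thesis by (simp add: poly_altdef)
qed

lemma subfield_pderiv:
  assumes L: "is_subfield L" and f: "\<And>i. coeff f i \<in> L"
  shows "coeff (pderiv f) i \<in> L"
proof -
  \<comment> \<open>Differentiation brings in integer factors, which lie in every subfield.\<close>
  have "of_nat m \<in> L" for m
    by (induction m) (use L in \<open>auto simp: is_subfield_def\<close>)
  thus ?thesis using L f unfolding coeff_pderiv is_subfield_def by blast
qed

section \<open>Lagrange interpolation at the roots\<close>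

lemma monic_eq_prod_roots:
  fixes g :: "'a::field poly"
  assumes "lead_coeff g = 1" "A = {x. poly g x = 0}" "card A = degree g" "finite A"
  shows "g = (\<Prod>y\<in>A. [:- y, 1:])"
proof -
  let ?P = "\<Prod>y\<in>A. [:- y, 1:]"
  have d: "degree ?P = card A" by (subst degree_prod_eq_sum_degree) auto
  have "lead_coeff ?P = 1" by (simp add: lead_coeff_prod)
  with d have "coeff ?P (degree g) = 1" using assms(3) by simp
  thus ?thesis using assms d
    by (intro poly_eqI_degree_lead_coeff[of g "degree g" _ A]) (auto simp: poly_prod prod_zero_iff)
qed

lemma poly_pderiv_prod_root:
  fixes x :: "'a::field"
  assumes "finite A" "x \<in> A"
  shows "poly (pderiv (\<Prod>y\<in>A. [:- y, 1:])) x = (\<Prod>y\<in>A - {x}. x - y)"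
proof -
  have "(\<Prod>y\<in>A. [:- y, 1:]) = [:- x, 1:] * (\<Prod>y\<in>A - {x}. [:- y, 1:])"
    using assms by (rule prod.remove)
  \<comment> \<open>At \<open>x\<close> only the term that differentiates the factor
    \<open>[:- x, 1:]\<close> survives.\<close>
  also have "poly (pderiv \<dots>) x = poly (\<Prod>y\<in>A - {x}. [:- y, 1:]) x"
    unfolding pderiv_mult by (simp add: pderiv_pCons)
  finally show ?thesis by (simp add: poly_prod)
qed

text \<open>\<open>f\<close> equals its Lagrange interpolant \<open>F\<close> on \<open>A\<close>.
  The basis polynomials \<open>l x\<close> are monic of degree \<open>card A - 1\<close>, so
  comparing coefficients there gives the sum.\<close>

lemma sum_div_pderiv:
  fixes f :: "'a::field poly"
  assumes A: "finite A" and f: "degree f < card A"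
  shows "(\<Sum>x\<in>A. poly f x / poly (pderiv (\<Prod>y\<in>A. [:- y, 1:])) x) = coeff f (card A - 1)"
proof -
  define D where "D x = (\<Prod>y\<in>A - {x}. x - y)" for x
  define l where "l x = (\<Prod>y\<in>A - {x}. [:- y, 1:])" for x
  define F where "F = (\<Sum>x\<in>A. smult (poly f x / D x) (l x))"
  have D0: "D x \<noteq> 0" for x using A by (auto simp: D_def)
  have dl: "degree (l x) = card A - 1" if "x \<in> A" for x
    unfolding l_def using that A by (subst degree_prod_eq_sum_degree) auto
  have cl: "coeff (l x) (card A - 1) = 1" if "x \<in> A" for x
    using dl[OF that] lead_coeff_prod[of "\<lambda>y. [:- y, 1:]" "A - {x}"] by (simp add: l_def)
  have "f = F"
  proof (rule poly_eqI_degree)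
    fix z assume z: "z \<in> A"
    have "poly F z = (\<Sum>x\<in>A. if x = z then poly f z else 0)"
      unfolding F_def poly_sum
    proof (rule sum.cong[OF refl])
      fix x assume "x \<in> A"
      show "poly (smult (poly f x / D x) (l x)) z = (if x = z then poly f z else 0)"
      proof (cases "x = z")
        case True
        thus ?thesis using D0[of z] by (simp add: l_def D_def poly_prod)
      next
        case False
        hence "poly (l x) z = 0" using A z by (auto simp: l_def poly_prod)
        thus ?thesis using False by simp
      qed
    qed
    thus "poly f z = poly F z" using A z by simp
  next
    have "degree F \<le> card A - 1" unfolding F_def
      using dl by (intro degree_sum_le A) (metis degree_smult_le order.trans order.refl)
    thus "degree F < card A" using f by linarith
  qed (rule f)
  hence "coeff f (card A - 1) = coeff F (card A - 1)" by (rule arg_cong)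
  also have "\<dots> = (\<Sum>x\<in>A. poly f x / D x)"
    using cl by (auto simp: F_def coeff_sum intro!: sum.cong)
  also have "\<dots> = (\<Sum>x\<in>A. poly f x / poly (pderiv (\<Prod>y\<in>A. [:- y, 1:])) x)"
    using poly_pderiv_prod_root[OF A] by (intro sum.cong) (auto simp: D_def)
  finally show ?thesis by simp
qed

text \<open>Modulo \<open>g\<close>, the quotient of \<open>P\<close> is at most linear and the
  remainder \<open>R\<close> has degree below \<open>n\<close>, so Lagrange interpolation applies to
  \<open>R\<close>, which agrees with \<open>P\<close> at the roots.\<close>

lemma sum_div_pderiv_quadrinomial:
  fixes g P :: "'a::field poly"
  assumes n: "n \<ge> 3" and g: "g = monom 1 n + monom a (n - 1) + monom b (n - 2) + [:c:]"
    and A: "A = {x. poly g x = 0}" "card A = n" and P: "degree P \<le> n + 1"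
  shows "(\<Sum>x\<in>A. poly P x / poly (pderiv g) x) =
    coeff P (n - 1) - a * coeff P n + (a\<^sup>2 - b) * coeff P (n + 1)"
    and "\<And>x. x \<in> A \<Longrightarrow> poly (pderiv g) x \<noteq> 0"
proof -
  have fin: "finite A" using A(2) n by (metis card.infinite not_numeral_le_zero)
  have cg: "coeff g m = (if m = n then 1 else 0) + (if m = n - 1 then a else 0) +
      (if m = n - 2 then b else 0) + (if m = 0 then c else 0)" for m
    by (simp add: g coeff_pCons split: nat.split)
  have deg: "degree g = n"
    using n by (intro antisym degree_le le_degree) (auto simp: cg)
  have g_prod: "g = (\<Prod>y\<in>A. [:- y, 1:])"
    using n A fin by (intro monic_eq_prod_roots) (auto simp: deg cg)
  \<comment> \<open>The linear term of the quotient clears degree \<open>n + 1\<close> but adds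
    \<open>a * coeff P (n + 1)\<close> in degree \<open>n\<close>; \<open>B\<close> clears what is
    left there.\<close>
  define B where "B = coeff P n - a * coeff P (n + 1)"
  define R where "R = P - g * [:B, coeff P (n + 1):]"
  have cR: "coeff R m = coeff P m - (B * coeff g m +
      (case m of 0 \<Rightarrow> 0 | Suc m' \<Rightarrow> coeff P (n + 1) * coeff g m'))" for m
    by (simp add: R_def coeff_pCons split: nat.split)
  have "coeff R m = 0" if m: "m > n - 1" for m
  proof -
    consider "m = n" | "m = n + 1" | "m > n + 1" using m by linarith
    thus ?thesis
    proof cases
      case 3
      thus ?thesis using P coeff_eq_0[of P m] by (auto simp: cR cg split: nat.split)
    qed (use n in \<open>auto simp: cR cg B_def split: nat.split\<close>)
  qed
  hence "degree R \<le> n - 1" by (intro degree_le) auto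
  hence "degree R < card A" using n A(2) by simp
  from sum_div_pderiv[OF fin this]
  have "(\<Sum>x\<in>A. poly R x / poly (pderiv g) x) = coeff R (n - 1)" using A(2) g_prod by simp
  moreover have "poly R x = poly P x" if "x \<in> A" for x
    using that A(1) by (simp add: R_def)
  \<comment> \<open>Since \<open>n \<ge> 3\<close>, the constant term \<open>c\<close> does not
    reach this coefficient.\<close>
  moreover have "coeff R (n - 1) = coeff P (n - 1) - (B * a + coeff P (n + 1) * b)"
    using n by (auto simp: cR cg split: nat.split)
  ultimately show "(\<Sum>x\<in>A. poly P x / poly (pderiv g) x) =
    coeff P (n - 1) - a * coeff P n + (a\<^sup>2 - b) * coeff P (n + 1)"
    by (simp add: B_def algebra_simps power2_eq_square)
  \<comment> \<open>The value is a product of differences of distinct roots.\<close>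
  show "poly (pderiv g) x \<noteq> 0" if "x \<in> A" for x
    using poly_pderiv_prod_root[OF fin that] fin by (simp flip: g_prod)
qed

section \<open>Dimension, minimum distance and inner products\<close>

text \<open>Differences of code words are code words, so the weight bound controls distances; as
  \<open>d > 0\<close>, it also forces the generators to be independent.\<close>

lemma is_linear_code_range:
  fixes e :: "nat \<Rightarrow> 'a::field ^ 'n"
  assumes k: "k > 0" and d: "d > 0"
    and wt: "\<And>f j. j < k \<Longrightarrow> f j \<noteq> 0 \<Longrightarrow> d \<le> card {i. (\<Sum>j<k. f j *s e j) $ i \<noteq> 0}"
  shows "is_linear_code CARD('n) k d (range (\<lambda>f. \<Sum>j<k. f j *s e j))"
proof -
  define w where "w f = (\<Sum>j<k. f j *s e j)" for f
  have wadd: "w f + w g = w (\<lambda>j. f j + g j)" for f g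
    by (simp add: w_def vec.scale_left_distrib sum.distrib)
  have wscale: "x *s w f = w (\<lambda>j. x * f j)" for x f
    by (simp add: w_def vec.scale_sum_right)
  have wdiff: "w f - w g = w (\<lambda>j. f j - g j)" for f g
    by (simp add: w_def vec.scale_left_diff_distrib sum_subtractf)
  have w0: "w (\<lambda>_. 0) = 0" by (simp add: w_def)
  \<comment> \<open>The zero word has weight 0, below \<open>d\<close>.\<close>
  have zero: "f j = 0" if "w f = 0" "j < k" for f j
    using wt[of j f] that d by (fastforce simp: w_def)
  have we: "w (\<lambda>i. if i = j then 1 else 0) = e j" if "j < k" for j
    using that by (simp add: w_def if_distrib[of "\<lambda>x. x *s _"] cong: if_cong)
  \<comment> \<open>Independence and dimension concern the set of generators, so no two of them may
    coincide.\<close>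
  have inj: "inj_on e {..<k}"
  proof (rule inj_onI, rule ccontr)
    fix i j assume ij: "i \<in> {..<k}" "j \<in> {..<k}" "e i = e j" "i \<noteq> j"
    hence "w (\<lambda>l. (if l = i then 1 else 0) - (if l = j then 1 else 0)) = 0"
      by (simp flip: wdiff add: we)
    from zero[OF this, of i] ij show False by simp
  qed
  have sub: "vec.subspace (range w)"
    unfolding vec.subspace_def using w0 by (auto simp: wadd wscale)
  have indep: "vec.independent (e ` {..<k})"
  proof (rule vec.independent_if_scalars_zero)
    fix u x assume "(\<Sum>x\<in>e ` {..<k}. u x *s x) = 0" "x \<in> e ` {..<k}"
    moreover have "(\<Sum>x\<in>e ` {..<k}. u x *s x) = w (u \<circ> e)"
      by (simp add: sum.reindex[OF inj] w_def)
    ultimately show "u x = 0" using zero[of "u \<circ> e"] by auto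
  qed simp
  have dim: "vec.dim (range w) = k"
  proof (rule vec.dim_unique[OF _ _ indep])
    show "e ` {..<k} \<subseteq> range w" by (auto simp flip: we)
    show "range w \<subseteq> vec.span (e ` {..<k})"
      unfolding w_def
      by (intro image_subsetI vec.span_sum vec.span_scale vec.span_base) auto
  qed (simp add: card_image inj)
  let ?D = "{hamming_dist x y | x y. x \<in> range w \<and> y \<in> range w \<and> x \<noteq> y}"
  have "d \<le> m" if m_in: "m \<in> ?D" for m
  proof -
    obtain f g where m: "m = hamming_dist (w f) (w g)" and ne: "w f \<noteq> w g"
      using m_in by blast
    have "\<exists>j<k. f j \<noteq> g j"
    proof (rule ccontr)
      assume "\<not> ?thesis"
      hence "w f = w g" by (auto simp: w_def intro: sum.cong)
      with ne show False by simp
    qed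
    then obtain j where j: "j < k" "f j \<noteq> g j" by blast
    have "d \<le> card {i. w (\<lambda>j. f j - g j) $ i \<noteq> 0}"
      unfolding w_def using j by (intro wt[of j]) auto
    also have "{i. w (\<lambda>j. f j - g j) $ i \<noteq> 0} = {i. w f $ i \<noteq> w g $ i}"
      by (simp flip: wdiff)
    finally show ?thesis by (simp add: m hamming_dist_def)
  qed
  \<comment> \<open>Two distinct words are needed, since \<open>Inf\<close> of the empty set would
    be 0.\<close>
  moreover have "?D \<noteq> {}"
  proof -
    have "e 0 \<noteq> 0" using zero[of "\<lambda>i. if i = 0 then 1 else 0" 0] k we[of 0] by auto
    hence "w (\<lambda>i. if i = 0 then 1 else 0) \<noteq> w (\<lambda>_. 0)" using k by (simp add: we w0)
    thus ?thesis by blast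
  qed
  ultimately have "d \<le> min_hamming_dist (range w)"
    unfolding min_hamming_dist_def by (intro cInf_greatest) auto
  with sub dim show ?thesis by (simp add: is_linear_code_def w_def[abs_def])
qed

text \<open>Zero positions of the word inject into the roots of \<open>f\<close>.\<close>

lemma card_ev_nonzero:
  fixes \<alpha> v :: "'a::field ^ 'n"
  assumes "inj (($) \<alpha>)" "\<And>i. v $ i \<noteq> 0" "f \<noteq> 0"
  shows "CARD('n) - degree f \<le> card {i. ev \<alpha> v f $ i \<noteq> 0}"
proof -
  let ?Z = "{i. poly f (\<alpha> $ i) = 0}"
  have "card ?Z = card (($) \<alpha> ` ?Z)"
    using assms(1) by (metis card_image inj_on_subset subset_UNIV)
  also have "\<dots> \<le> card {x. poly f x = 0}"
    by (intro card_mono poly_roots_finite assms) auto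
  also have "\<dots> \<le> degree f" by (rule card_poly_roots_bound) fact
  finally have "card ?Z \<le> degree f" .
  moreover have "{i. ev \<alpha> v f $ i \<noteq> 0} = UNIV - ?Z"
    using assms(2) by (auto simp: ev_def)
  moreover have "card (UNIV - ?Z) = CARD('n) - card ?Z" by (rule card_Diff_subset) auto
  ultimately show ?thesis by simp
qed

lemma ev_sum: "ev \<alpha> v (\<Sum>j\<in>J. smult (f j) (F j)) = (\<Sum>j\<in>J. f j *s ev \<alpha> v (F j))"
  by (simp add: ev_def vec_eq_iff poly_sum sum_distrib_left mult.left_commute)

text \<open>Two indices of at most \<open>D + 2\<close> with sum at least \<open>2 * D + 2\<close>
  are both at least \<open>D\<close>.\<close>

lemma coeff_mult_top:
  fixes F H :: "'a::comm_ring_1 poly"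
  assumes F: "degree F \<le> D + 2" and H: "degree H \<le> D + 2"
  shows "coeff (F * H) (2 * D + 2) =
      coeff F D * coeff H (D + 2) + coeff F (D + 1) * coeff H (D + 1) + coeff F (D + 2) * coeff H D"
    and "coeff (F * H) (2 * D + 3) =
      coeff F (D + 1) * coeff H (D + 2) + coeff F (D + 2) * coeff H (D + 1)"
    and "coeff (F * H) (2 * D + 4) = coeff F (D + 2) * coeff H (D + 2)"
proof -
  have *: "coeff (F * H) m = (\<Sum>i\<in>{D, D + 1, D + 2}. coeff F i * coeff H (m - i))"
    if "m \<ge> 2 * D + 2" for m
    unfolding coeff_mult
  proof (rule sum.mono_neutral_right)
    show "\<forall>i\<in>{..m} - {D, D + 1, D + 2}. coeff F i * coeff H (m - i) = 0"
    proof
      fix i assume i: "i \<in> {..m} - {D, D + 1, D + 2}"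
      hence "i > D + 2 \<or> m - i > D + 2" using that by auto
      thus "coeff F i * coeff H (m - i) = 0" using F H coeff_eq_0[of F i] coeff_eq_0[of H "m - i"]
        by fastforce
    qed
  qed (use that in auto)
  \<comment> \<open>These are the out-of-range partners of the indices \<open>D\<close> and
    \<open>D + 1\<close> in the last two sums.\<close>
  have "coeff H (D + 3) = 0" "coeff H (D + 4) = 0" using H by (auto intro!: coeff_eq_0)
  thus "coeff (F * H) (2 * D + 2) =
      coeff F D * coeff H (D + 2) + coeff F (D + 1) * coeff H (D + 1) + coeff F (D + 2) * coeff H D"
    and "coeff (F * H) (2 * D + 3) =
      coeff F (D + 1) * coeff H (D + 2) + coeff F (D + 2) * coeff H (D + 1)"
    and "coeff (F * H) (2 * D + 4) = coeff F (D + 2) * coeff H (D + 2)"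
    by (simp_all add: * eval_nat_numeral)
qed

theorem theorem30:
  fixes p s h t r q n k :: nat
    and a b c \<eta>1 \<eta>2 :: "'a :: {field, finite}"
    and K L :: "'a set"
    and g :: "'a poly"
    and \<alpha> :: "'a ^ 'n"
    and S1 :: "'a poly set"
  assumes "prime p" "odd p"
    and "s > 0" "h > 0" "t > 0" "r > 0"
    and "odd r" "t dvd h" "s \<le> h" "gcd r p = 1"
    and "q = p ^ h"
    and "CARD('a) = q ^ 2"
    and "n = r * p ^ s" "CARD('n) = n"
    and "k = (n - 1) div 2"
    and "is_subfield K" "card K = p ^ t"
    and "is_subfield L" "card L = q"
    and "a \<in> K" "b \<in> K" "c \<in> K" "a \<noteq> 0" "b \<noteq> 0" "c \<noteq> 0"
    and "g = monom 1 n + monom a (n - 1) + monom b (n - 2) + [:c:]"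
    and "is_splitting_field K L g"
    and "inj (($) \<alpha>)" "range (($) \<alpha>) = {x. poly g x = 0}"
    and "\<eta>2 = 2 * inverse b" "\<eta>1 = 2 * a * inverse b"
    and "S1 = {(\<Sum>i<k. monom (f i) i) +
               smult (2 / b * f (k - 1)) (monom a k + monom 1 (k + 1)) | f :: nat \<Rightarrow> 'a. True}"
  shows "(\<forall>i. poly (pderiv g) (\<alpha> $ i) \<noteq> 0 \<and>
              (\<exists>w. w ^ 2 = inverse (poly (pderiv g) (\<alpha> $ i)))) \<and>
         (\<forall>v :: 'a ^ 'n. (\<forall>i. (v $ i) ^ 2 = inverse (poly (pderiv g) (\<alpha> $ i))) \<longrightarrow>
              is_linear_code n k k (ev \<alpha> v ` S1) \<and>
              self_orthogonal (ev \<alpha> v ` S1) \<and>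
              is_tgrs_code \<alpha> v k (ev \<alpha> v ` S1))"
proof -
  note q = \<open>q = p ^ h\<close> and Q = \<open>CARD('a) = q ^ 2\<close> and n_CARD = \<open>CARD('n) = n\<close>
    and b = \<open>b \<noteq> 0\<close> and g = \<open>g = _\<close> and split = \<open>is_splitting_field K L g\<close>
    and inj = \<open>inj (($) \<alpha>)\<close> and S1 = \<open>S1 = _\<close> and rng = \<open>range (($) \<alpha>) = _\<close>
    and L = \<open>is_subfield L\<close> \<open>card L = q\<close>
  have "p \<ge> 3" using \<open>prime p\<close> \<open>odd p\<close> prime_ge_2_nat[of p] by (cases "p = 2") auto
  also have "p \<le> p ^ s" using \<open>p \<ge> 3\<close> \<open>s > 0\<close> by (intro self_le_power) auto
  also have "\<dots> \<le> n" using \<open>r > 0\<close> \<open>n = r * p ^ s\<close> by simp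
  finally have n3: "n \<ge> 3" .
  have "odd n" using \<open>odd p\<close> \<open>odd r\<close> \<open>n = r * p ^ s\<close> by simp
  with \<open>k = _\<close> n3 have nk: "n = 2 * k + 1" and k: "k > 0" by auto
  have roots: "{x. poly g x = 0} = range (($) \<alpha>)" "card (range (($) \<alpha>)) = n"
    using rng card_image[OF inj] n_CARD by simp_all
  note sum_g = sum_div_pderiv_quadrinomial(1)[OF n3 g roots(1)[symmetric] roots(2)]
  \<comment> \<open>The polynomial \<open>P\<close> is taken to be 0, which meets the degree bound
    trivially.\<close>
  have g'_nz: "poly (pderiv g) (\<alpha> $ i) \<noteq> 0" for i
    using sum_div_pderiv_quadrinomial(2)[OF n3 g roots(1)[symmetric] roots(2), of 0] by simp
  have sqrt_ex: "\<exists>w. w ^ 2 = inverse (poly (pderiv g) (\<alpha> $ i))" for i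
  proof (rule subfield_square_exists[OF L(1)])
    have "coeff g j \<in> L" for j using split by (auto simp: is_splitting_field_def)
    moreover have "\<alpha> $ i \<in> L" using is_splitting_field_roots[OF split] rng by blast
    ultimately have "poly (pderiv g) (\<alpha> $ i) \<in> L"
      using L(1) by (intro subfield_poly subfield_pderiv)
    thus "inverse (poly (pderiv g) (\<alpha> $ i)) \<in> L" using L(1) by (simp add: is_subfield_def)
  qed (use Q L q \<open>odd p\<close> in auto)

  define G where "G f = (\<Sum>i<k. monom (f i) i) +
    smult (2 / b * f (k - 1)) (monom a k + monom 1 (k + 1))" for f
  have S1_G: "S1 = range G" unfolding S1 G_def by auto
  have coeff_G: "coeff (G f) m = (if m < k then f m else 0) +
      2 / b * f (k - 1) * ((if m = k then a else 0) + (if m = k + 1 then 1 else 0))" for f m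
    by (auto simp: G_def coeff_sum)
  have deg_G: "degree (G f) \<le> k + 1" for f by (intro degree_le) (auto simp: coeff_G)
  \<comment> \<open>These polynomials form a basis of \<open>S1\<close>; the whole twist sits on the
    last one.\<close>
  define E where "E i = monom 1 i +
    (if i = k - 1 then smult (2 / b) (monom a k + monom 1 (k + 1)) else 0)" for i
  have G_E: "G f = (\<Sum>i<k. smult (f i) (E i))" for f
  proof -
    have "(\<Sum>i<k. smult (f i) (E i)) = (\<Sum>i<k. monom (f i) i +
        (if i = k - 1 then smult (2 / b * f (k - 1)) (monom a k + monom 1 (k + 1)) else 0))"
      by (intro sum.cong refl) (simp add: E_def smult_add_right smult_monom mult_ac)
    thus ?thesis using k by (simp add: G_def sum.distrib)
  qed

  have code: "is_linear_code n k k (ev \<alpha> v ` S1) \<and>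
      self_orthogonal (ev \<alpha> v ` S1) \<and> is_tgrs_code \<alpha> v k (ev \<alpha> v ` S1)"
    if v: "\<forall>i. (v $ i) ^ 2 = inverse (poly (pderiv g) (\<alpha> $ i))" for v :: "'a ^ 'n"
  proof (intro conjI)
    have v0: "v $ i \<noteq> 0" for i using v g'_nz[of i] by (metis inverse_zero_imp_zero zero_power2)
    have "k \<le> card {i. (\<Sum>j<k. f j *s ev \<alpha> v (E j)) $ i \<noteq> 0}" if "j < k" "f j \<noteq> 0" for f j
    proof -
      \<comment> \<open>The twist only touches degrees \<open>k\<close> and \<open>k + 1\<close>, so
        this coefficient is \<open>f j\<close>.\<close>
      have "coeff (G f) j \<noteq> 0" using that by (simp add: coeff_G)
      hence "G f \<noteq> 0" by auto
      from card_ev_nonzero[OF inj v0 this] deg_G[of f]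
      \<comment> \<open>Here \<open>n - (k + 1) = k\<close>.\<close>
      have "k \<le> card {i. ev \<alpha> v (G f) $ i \<noteq> 0}" using n_CARD nk by linarith
      thus ?thesis by (simp add: G_E ev_sum)
    qed
    from is_linear_code_range[OF k k this]
    show "is_linear_code n k k (ev \<alpha> v ` S1)"
      by (simp add: n_CARD S1_G image_image G_E ev_sum)

    have "(\<Sum>i\<in>UNIV. ev \<alpha> v (G f) $ i * ev \<alpha> v (G f') $ i) = 0" for f f'
    proof -
      let ?P = "G f * G f'"
      \<comment> \<open>The factor \<open>(v $ i)\<^sup>2\<close> supplies the reciprocal of the
        derivative.\<close>
      have "(\<Sum>i\<in>UNIV. ev \<alpha> v (G f) $ i * ev \<alpha> v (G f') $ i) =
          (\<Sum>i\<in>UNIV. poly ?P (\<alpha> $ i) / poly (pderiv g) (\<alpha> $ i))"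
        using v by (intro sum.cong refl)
          (simp add: ev_def divide_inverse power2_eq_square mult_ac flip: v[rule_format])
      also have "\<dots> = (\<Sum>x\<in>range (($) \<alpha>). poly ?P x / poly (pderiv g) x)"
        by (simp add: sum.reindex[OF inj])
      \<comment> \<open>The product has degree at most \<open>2 * (k + 1) = n + 1\<close>.\<close>
      also have "\<dots> = coeff ?P (n - 1) - a * coeff ?P n + (a\<^sup>2 - b) * coeff ?P (n + 1)"
        using degree_mult_le[of "G f" "G f'"] deg_G[of f] deg_G[of f'] nk by (intro sum_g) linarith
      also have "\<dots> = 0"
      proof -
        \<comment> \<open>In degrees \<open>D\<close>, \<open>D + 1\<close>, \<open>D + 2\<close>
          the coefficients of \<open>G f\<close> are \<open>f (k - 1)\<close> times
          \<open>1\<close>, \<open>2 * a / b\<close>, \<open>2 / b\<close>. Up to the factor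
          \<open>f (k - 1) * f' (k - 1)\<close> the sum is
          \<open>(4/b + 4*a^2/b^2) - 8*a^2/b^2 + (a^2 - b) * 4/b^2 = 0\<close>.\<close>
        obtain D where D: "k = D + 1" using k by (cases k) auto
        have "degree (G f) \<le> D + 2" "degree (G f') \<le> D + 2"
          using deg_G[of f] deg_G[of f'] D by auto
        note top = coeff_mult_top[OF this]
        have n_D: "n - 1 = 2 * D + 2" "n = 2 * D + 3" "n + 1 = 2 * D + 4" using nk D by auto
        note coeffs = top[folded n_D(1), folded n_D(3), folded n_D(2)]
        show ?thesis unfolding coeffs using b
          by (simp add: coeff_G D power2_eq_square field_simps)
      qed
      finally show ?thesis .
    qed
    thus "self_orthogonal (ev \<alpha> v ` S1)"
      by (auto simp: self_orthogonal_def dual_code_def S1_G)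

    \<comment> \<open>Rows count from 1, so row \<open>k\<close> belongs to
      \<open>f (k - 1)\<close>; columns 1 and 2 stand for degrees \<open>k\<close> and
      \<open>k + 1\<close>.\<close>
    define \<eta> where "\<eta> i j =
      (if i = k then if j = 1 then 2 / b * a else if j = 2 then 2 / b else 0 else 0)" for i j :: nat
    have twist: "(\<Sum>j=1..n-k. monom (\<eta> (i + 1) j) (k - 1 + j)) =
        (if i = k - 1 then smult (2 / b) (monom a k + monom 1 (k + 1)) else 0)" if "i < k" for i
    proof -
      \<comment> \<open>Both columns exist because \<open>n - k = k + 1 \<ge> 2\<close>.\<close>
      have "(\<Sum>j=1..n-k. monom (\<eta> (i + 1) j) (k - 1 + j)) =
          (\<Sum>j\<in>{1, 2}. monom (\<eta> (i + 1) j) (k - 1 + j))"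
        using nk k by (intro sum.mono_neutral_right) (auto simp: \<eta>_def)
      thus ?thesis using k that
        by (auto simp: \<eta>_def smult_add_right smult_monom)
    qed
    have "(\<Sum>i<k. monom (f i) i) +
        (\<Sum>i<k. smult (f i) (\<Sum>j=1..n-k. monom (\<eta> (i + 1) j) (k - 1 + j))) = G f" for f
      unfolding G_E E_def smult_add_right sum.distrib
      by (intro arg_cong2[of _ _ _ _ "(+)"] sum.cong refl) (simp add: smult_monom,
          simp only: twist lessThan_iff smult_add_right)
    hence "tgrs_polys n k \<eta> = S1" by (auto simp: tgrs_polys_def S1_G)
    thus "is_tgrs_code \<alpha> v k (ev \<alpha> v ` S1)"
      unfolding is_tgrs_code_def using inj v0 k nk n_CARD by auto
  qed
  show ?thesis using g'_nz sqrt_ex code by blast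
qed

end
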